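(* Let $F\subset K[x_1][\tilde x]\setminus K[x_1]$ be a finite set of polynomials generating a zero-dimensional ideal of $K[x_1,\dots,x_n]$. Then the algorithm consisting of the following sequence of instructions terminates in finitely many steps. A1. Start with the prebasis set $G:=F$, the multiplier set $\Lambda:=\emptyset$ in $K[x_1]$, the temporary set $\mathcal S:=\emptyset$ of $S$-polynomials, and the temporary pre-eliminant $\chi_0:=0$. A2. For each pair $f,g\in G$ with $f\ne g$, execute A3. A3. If $\mathrm{LM}(f)$ and $\mathrm{LM}(g)$ are relatively prime, add $d:=\gcd(\mathrm{LC}(f),\mathrm{LC}(g))$ into $\Lambda$ if $d\in K[x_1]\setminus K$; else if there exists $h\in G\setminus\{f,g\}$ such that $\mathrm{lcm}(\mathrm{LM}(f),\mathrm{LM}(g))\in\langle\mathrm{LM}(h)\rangle$, add $\lambda:=\mathrm{LC}(h)/\gcd\bigl(\mathrm{lcm}(\mathrm{LC}(f),\mathrm{LC}(g)),\mathrm{LC}(h)\bigr)$ into $\Lambda$ if $\lambda\in K[x_1]\setminus K$; else compute the $S$-polynomial $S(f,g)$ and add it into $\mathcal S$. A4. For every $S\in\mathcal S$, make a proper reduction of $S$ by $G$ to obtain a remainder $r$. If the multiplier $\lambda$ of this proper reduction satisfies $\lambda\in K[x_1]\setminus K$, add $\lambda$ into $\Lambda$. Delete $S$ from $\mathcal S$. If $r\in K[x_1]\setminus K$, redefine $\chi_0:=\gcd(r,\chi_0)$; else if $r\in K[x_1][\tilde x]\setminus K[x_1]$, add $r$ into $G$ and, for every $f\in G\setminus\{r\}$,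 execute A3 for the pair $f,r$; else if $r\in K\setminus\{0\}$, halt the algorithm and output $G=\{1\}$. A5. Repeat A4 until $\mathcal S=\emptyset$. A6. For every $f\in G$, if $d:=\gcd(\mathrm{LC}(f),\chi_0)\in K[x_1]\setminus K$, add $d$ into $\Lambda$. A7. Return the pre-eliminant $\chi_0\in K[x_1]\setminus\{0\}$, the prebasis $G\subset K[x_1][\tilde x]\setminus K[x_1]$, and the multiplier set $\Lambda\subset K[x_1]\setminus K$.
   Context: Let $K$ be a field, $\tilde x=(x_2,\dots,x_n)$, and regard $K[x_1,\dots,x_n]$ as the algebra $K[x_1][\tilde x]$ over $K[x_1]$. Let $[\tilde x]$ be the set of monomials $\tilde x^\alpha=x_2^{\alpha_2}\cdots x_n^{\alpha_n}$, ordered by the lexicographic ordering with $x_2\prec\cdots\prec x_n$. For $f=\sum_\alpha c_\alpha\tilde x^\alpha$ with $c_\alpha\in K[x_1]$, let $\mathrm{supp}(f)=\{\tilde x^\alpha : c_\alpha\neq0\}$. For $f\ne 0$, $\mathrm{LM}(f)\in[\tilde x]$ is the largest monomial in $\mathrm{supp}(f)$, $\mathrm{LC}(f)\in K[x_1]\setminus\{0\}$ is its coefficient, and $\mathrm{LT}(f)=\mathrm{LC}(f)\mathrm{LM}(f)$. For nonzero $a,b\in K[x_1]$, $\gcd(a,b)$ is monic and $\mathrm{lcm}(a,b)=ab/\gcd(a,b)$; $\gcd(a,0)$ is the monic associate of $a$. $S$-polynomial: for $f,g\in K[x_1][\tilde x]\setminus K[x_1]$, $S(f,g)=\frac{m\tilde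 x^\gamma}{\mathrm{LT}(f)}f-\frac{m\tilde x^\gamma}{\mathrm{LT}(g)}g$ with $m=\mathrm{lcm}(\mathrm{LC}(f),\mathrm{LC}(g))$ and $\tilde x^\gamma=\mathrm{lcm}(\mathrm{LM}(f),\mathrm{LM}(g))$. Proper term reduction of a term $c_\alpha\tilde x^\alpha$ of $f$ by $g\neq0$ with $\mathrm{LM}(g)\mid\tilde x^\alpha$: $f$ is replaced by $\mu f-\frac{m\tilde x^\alpha}{\mathrm{LT}(g)}g$, where $m=\mathrm{lcm}(c_\alpha,\mathrm{LC}(g))$ and $\mu=m/c_\alpha$ is the least multiplier. A proper reduction of $f$ by a finite set $B=\{b_1,\dots,b_s\}\subset K[x_1][\tilde x]\setminus K[x_1]$ is a finite sequence of proper term reductions by elements of $B$, yielding $\lambda f=\sum_{j}q_jb_j+r$, where $\lambda\in K[x_1]\setminus\{0\}$ (the multiplier) is the product of the least multipliers used, $q_j\in K[x_1][\tilde x]$, the remainder $r$ has no monomial divisible by any $\mathrm{LM}(b_j)$, and $\mathrm{LM}(f)=\max\{\max_j\mathrm{LM}(q_jb_j),\mathrm{LM}(r)\}$ (zero polynomials being ignored in the maximum).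
   Formalization: Only termination is asserted; the memberships in A7 are not claimed. χ_0 ≠ 0 fails for the algorithm as written: for n=2, F={x_2, x_2+x_1, x_2+x_1^2} every pair is discarded via the third polynomial and χ_0=0 is returned. *)

theory Defs
  imports
    "HOL-Library.Poly_Mapping"
    "HOL-Computational_Algebra.Polynomial"
begin

text \<open>
  A monomial \<open>x\<^sub>2\<^sup>\<alpha>\<^sup>2 \<cdots> x\<^sub>n\<^sup>\<alpha>\<^sup>n\<close> is its exponent function \<open>\<alpha>\<close> (key \<open>i\<close> is the variable \<open>x\<^sub>i\<close>),
  so multiplication of monomials is addition of exponents and \<open>1\<close> is the exponent \<open>0\<close>.
  An element of \<open>K[x\<^sub>1][x\<^sub>2,\<dots>,x\<^sub>n]\<close> is a finitely supported map from monomials to \<open>K[x\<^sub>1]\<close>,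
  \<open>K[x\<^sub>1]\<close> being the univariate polynomial type; \<open>Poly_Mapping.keys\<close> is \<open>supp\<close>.
\<close>

type_synonym monomial = "nat \<Rightarrow>\<^sub>0 nat"
type_synonym 'a mpol = "monomial \<Rightarrow>\<^sub>0 'a poly"

abbreviation scalar :: "'a::zero poly \<Rightarrow> 'a mpol" where
  "scalar c \<equiv> Poly_Mapping.single 0 c"

definition mpols :: "nat \<Rightarrow> 'a::zero mpol set" where
  "mpols n = {f. \<forall>\<alpha>\<in>Poly_Mapping.keys f. Poly_Mapping.keys \<alpha> \<subseteq> {2..n}}"

definition ideal_gen :: "nat \<Rightarrow> 'a::field mpol set \<Rightarrow> 'a mpol set" where
  "ideal_gen n F = {\<Sum>f\<in>A. q f * f | A q. finite A \<and> A \<subseteq> F \<and> (\<forall>f\<in>A. q f \<in> mpols n)}"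

text \<open>
  Zero-dimensionality of an ideal \<open>I\<close>: the quotient \<open>K[x\<^sub>1,\<dots>,x\<^sub>n]/I\<close> has finite dimension over \<open>K\<close>.
  The unit ideal is included, as the algorithm may output \<open>{1}\<close>.
\<close>

definition zero_dimensional :: "nat \<Rightarrow> 'a::field mpol set \<Rightarrow> bool" where
  "zero_dimensional n I \<longleftrightarrow>
     (\<exists>B. finite B \<and> B \<subseteq> mpols n \<and>
       (\<forall>p\<in>mpols n. \<exists>c :: 'a mpol \<Rightarrow> 'a. p - (\<Sum>b\<in>B. scalar [:c b:] * b) \<in> I))"

text \<open>
  The library's \<open>gcd\<close> on \<open>'a poly\<close> needs \<open>'a\<close> to be of class \<open>field_gcd\<close>, so the monic gcd over an
  arbitrary field is defined here.  The gcd of \<open>0\<close> and \<open>0\<close> is \<open>0\<close>.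
\<close>

definition pgcd :: "'a::field poly \<Rightarrow> 'a poly \<Rightarrow> 'a poly" where
  "pgcd a b = (THE d. (d = 0 \<or> lead_coeff d = 1) \<and> d dvd a \<and> d dvd b \<and>
                      (\<forall>e. e dvd a \<longrightarrow> e dvd b \<longrightarrow> e dvd d))"

definition plcm :: "'a::field poly \<Rightarrow> 'a poly \<Rightarrow> 'a poly" where
  "plcm a b = (a * b) div pgcd a b"

definition mono_dvd :: "monomial \<Rightarrow> monomial \<Rightarrow> bool" where
  "mono_dvd \<alpha> \<beta> \<longleftrightarrow> (\<exists>\<gamma>. \<beta> = \<alpha> + \<gamma>)"

definition mono_coprime :: "monomial \<Rightarrow> monomial \<Rightarrow> bool" where
  "mono_coprime \<alpha> \<beta> \<longleftrightarrow> (\<forall>\<gamma>. mono_dvd \<gamma> \<alpha> \<longrightarrow> mono_dvd \<gamma> \<beta> \<longrightarrow> \<gamma> = 0)"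

lift_definition mono_lcm :: "monomial \<Rightarrow> monomial \<Rightarrow> monomial"
  is "\<lambda>\<alpha> \<beta> i. max (\<alpha> i) (\<beta> i)"
proof -
  fix \<alpha> \<beta> :: "nat \<Rightarrow> nat"
  assume "finite {i. \<alpha> i \<noteq> 0}" "finite {i. \<beta> i \<noteq> 0}"
  then have "finite ({i. \<alpha> i \<noteq> 0} \<union> {i. \<beta> i \<noteq> 0})" by simp
  then show "finite {i. max (\<alpha> i) (\<beta> i) \<noteq> 0}"
    by (rule rev_finite_subset) (auto simp: max_def)
qed

text \<open>
  The variable with the largest index is the most significant one.  This is not the order of
  the \<open>linorder\<close> instance of \<open>poly_mapping\<close>, which compares at the smallest differing index.
\<close>

definition lex_less :: "monomial \<Rightarrow> monomial \<Rightarrow> bool" where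
  "lex_less \<alpha> \<beta> \<longleftrightarrow>
     (\<exists>i. Poly_Mapping.lookup \<alpha> i < Poly_Mapping.lookup \<beta> i \<and>
          (\<forall>j>i. Poly_Mapping.lookup \<alpha> j = Poly_Mapping.lookup \<beta> j))"

definition is_lex_max :: "monomial set \<Rightarrow> monomial \<Rightarrow> bool" where
  "is_lex_max M \<alpha> \<longleftrightarrow> \<alpha> \<in> M \<and> (\<forall>\<beta>\<in>M. \<beta> = \<alpha> \<or> lex_less \<beta> \<alpha>)"

definition LM :: "'a::zero mpol \<Rightarrow> monomial" where
  "LM f = (THE \<alpha>. is_lex_max (Poly_Mapping.keys f) \<alpha>)"

definition LC :: "'a::zero mpol \<Rightarrow> 'a poly" where
  "LC f = Poly_Mapping.lookup f (LM f)"

text \<open>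
  For \<open>LM g\<close> dividing \<open>\<alpha>\<close> and \<open>LC g\<close> dividing \<open>m\<close>, \<open>term_quot m \<alpha> g\<close> is the term
  \<open>m x\<^sup>\<alpha> / LT(g)\<close>.
\<close>

definition term_quot :: "'a::field poly \<Rightarrow> monomial \<Rightarrow> 'a mpol \<Rightarrow> 'a mpol" where
  "term_quot m \<alpha> g = Poly_Mapping.single (\<alpha> - LM g) (m div LC g)"

definition spoly :: "'a::field mpol \<Rightarrow> 'a mpol \<Rightarrow> 'a mpol" where
  "spoly f g =
     (let m = plcm (LC f) (LC g); \<gamma> = mono_lcm (LM f) (LM g)
      in term_quot m \<gamma> f * f - term_quot m \<gamma> g * g)"

text \<open>
  \<open>term_reduction p \<alpha> g \<mu> p'\<close>: the term of \<open>p\<close> at \<open>\<alpha>\<close> is reduced by \<open>g\<close> with least multiplier \<open>\<mu>\<close>,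
  giving \<open>p'\<close>.
\<close>

definition term_reduction ::
    "'a::field mpol \<Rightarrow> monomial \<Rightarrow> 'a mpol \<Rightarrow> 'a poly \<Rightarrow> 'a mpol \<Rightarrow> bool" where
  "term_reduction p \<alpha> g \<mu> p' \<longleftrightarrow>
     \<alpha> \<in> Poly_Mapping.keys p \<and> g \<noteq> 0 \<and> mono_dvd (LM g) \<alpha> \<and>
     (let c = Poly_Mapping.lookup p \<alpha>; m = plcm c (LC g)
      in \<mu> = m div c \<and> p' = scalar \<mu> * p - term_quot m \<alpha> g * g)"

inductive reduction_seq ::
    "'a::field mpol set \<Rightarrow> 'a mpol \<Rightarrow> 'a poly \<Rightarrow> 'a mpol \<Rightarrow> bool"
  for B f where
  refl: "reduction_seq B f 1 f"
| step: "reduction_seq B f l p \<Longrightarrow> g \<in> B \<Longrightarrow> term_reduction p \<alpha> g \<mu> p' \<Longrightarrow>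
         reduction_seq B f (\<mu> * l) p'"

text \<open>\<open>proper_reduction B f l r\<close>: \<open>l\<close> is the multiplier and \<open>r\<close> the remainder.\<close>

definition proper_reduction ::
    "'a::field mpol set \<Rightarrow> 'a mpol \<Rightarrow> 'a poly \<Rightarrow> 'a mpol \<Rightarrow> bool" where
  "proper_reduction B f l r \<longleftrightarrow>
     reduction_seq B f l r \<and> l \<noteq> 0 \<and>
     (\<forall>\<alpha>\<in>Poly_Mapping.keys r. \<forall>b\<in>B. \<not> mono_dvd (LM b) \<alpha>) \<and>
     (\<exists>q. scalar l * f = (\<Sum>b\<in>B. q b * b) + r \<and>
          (f \<noteq> 0 \<longrightarrow> is_lex_max (LM ` (((\<lambda>b. q b * b) ` B \<union> {r}) - {0})) (LM f)))"

text \<open>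
  In the following, \<open>0 < degree d\<close> expresses \<open>d \<in> K[x\<^sub>1] \<setminus> K\<close>, and \<open>range scalar\<close> is \<open>K[x\<^sub>1]\<close>.
\<close>

definition add_nonconst :: "'a::zero poly \<Rightarrow> 'a poly set \<Rightarrow> 'a poly set" where
  "add_nonconst d L = (if 0 < degree d then insert d L else L)"

text \<open>
  \<open>exec_pair G f g (L, SS) (L', SS')\<close>: instruction A3 for the pair \<open>f, g\<close> turns the multiplier set \<open>L\<close>
  and the set \<open>SS\<close> of S-polynomials into \<open>L'\<close> and \<open>SS'\<close>.  It is a relation, since the choice
  of \<open>h\<close> is free.  Membership in \<open>\<langle>LM(h)\<rangle>\<close> is divisibility by \<open>LM(h)\<close>.
\<close>

inductive exec_pair ::
    "'a::field mpol set \<Rightarrow> 'a mpol \<Rightarrow> 'a mpol \<Rightarrow>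
     'a poly set \<times> 'a mpol set \<Rightarrow> 'a poly set \<times> 'a mpol set \<Rightarrow> bool"
  for G f g where
  coprime:
    "mono_coprime (LM f) (LM g) \<Longrightarrow>
     exec_pair G f g (L, SS) (add_nonconst (pgcd (LC f) (LC g)) L, SS)"
| chain:
    "\<not> mono_coprime (LM f) (LM g) \<Longrightarrow> h \<in> G - {f, g} \<Longrightarrow>
     mono_dvd (LM h) (mono_lcm (LM f) (LM g)) \<Longrightarrow>
     exec_pair G f g (L, SS)
       (add_nonconst (LC h div pgcd (plcm (LC f) (LC g)) (LC h)) L, SS)"
| spoly:
    "\<not> mono_coprime (LM f) (LM g) \<Longrightarrow>
     \<not> (\<exists>h \<in> G - {f, g}. mono_dvd (LM h) (mono_lcm (LM f) (LM g))) \<Longrightarrow>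
     exec_pair G f g (L, SS) (L, insert (spoly f g) SS)"

text \<open>
  Machine states.  The arguments \<open>G L SS \<chi>\<close> are the current prebasis, multiplier set, set of
  S-polynomials and temporary pre-eliminant.
  \<^item> \<open>Pairs Q G L SS \<chi>\<close>: A3 is still to be executed for the unordered pairs in \<open>Q\<close>
    (during A2, and inside A4 after a remainder has been added to \<open>G\<close>);
  \<^item> \<open>Reduce G L SS \<chi>\<close>: the loop A4/A5;
  \<^item> \<open>Final T G L \<chi>\<close>: A6, still to be done for the elements of \<open>T\<close>;
  \<^item> \<open>Returned \<chi> G L\<close>: the output of A7;
  \<^item> \<open>Halted G\<close>: the algorithm was halted in A4 with output \<open>G\<close>.
\<close>

datatype ('c, 'p) machine =
    Pairs "'p set set" "'p set" "'c set" "'p set" 'c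
  | Reduce "'p set" "'c set" "'p set" 'c
  | Final "'p set" "'p set" "'c set" 'c
  | Returned 'c "'p set" "'c set"
  | Halted "'p set"

type_synonym 'a state = "('a poly, 'a mpol) machine"

definition start :: "'a::field mpol set \<Rightarrow> 'a state" where
  "start F = Pairs {{f, g} | f g. f \<in> F \<and> g \<in> F \<and> f \<noteq> g} F {} {} 0"

text \<open>
  The order in which pairs, S-polynomials and elements of \<open>G\<close> are treated, the orientation of a
  pair, and the proper reduction that is performed are all left open.
\<close>

inductive alg_step :: "'a::field state \<Rightarrow> 'a state \<Rightarrow> bool" where
  pair:
    "{f, g} \<in> Q \<Longrightarrow> f \<noteq> g \<Longrightarrow> exec_pair G f g (L, SS) (L', SS') \<Longrightarrow>
     alg_step (Pairs Q G L SS \<chi>) (Pairs (Q - {{f, g}}) G L' SS' \<chi>)"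
| pairs_done:
    "alg_step (Pairs {} G L SS \<chi>) (Reduce G L SS \<chi>)"
| reduce_eliminant:
    "S \<in> SS \<Longrightarrow> proper_reduction G S l r \<Longrightarrow> r = scalar c \<Longrightarrow> 0 < degree c \<Longrightarrow>
     alg_step (Reduce G L SS \<chi>) (Reduce G (add_nonconst l L) (SS - {S}) (pgcd c \<chi>))"
| reduce_new:
    "S \<in> SS \<Longrightarrow> proper_reduction G S l r \<Longrightarrow> r \<notin> range scalar \<Longrightarrow>
     alg_step (Reduce G L SS \<chi>)
       (Pairs {{f, r} | f. f \<in> insert r G - {r}} (insert r G) (add_nonconst l L) (SS - {S}) \<chi>)"
| reduce_unit:
    "S \<in> SS \<Longrightarrow> proper_reduction G S l r \<Longrightarrow> r = scalar c \<Longrightarrow> c \<noteq> 0 \<Longrightarrow> degree c = 0 \<Longrightarrow>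
     alg_step (Reduce G L SS \<chi>) (Halted {1})"
| reduce_zero:
    "S \<in> SS \<Longrightarrow> proper_reduction G S l r \<Longrightarrow> r = 0 \<Longrightarrow>
     alg_step (Reduce G L SS \<chi>) (Reduce G (add_nonconst l L) (SS - {S}) \<chi>)"
| reduce_done:
    "alg_step (Reduce G L {} \<chi>) (Final G G L \<chi>)"
| final:
    "f \<in> T \<Longrightarrow>
     alg_step (Final T G L \<chi>) (Final (T - {f}) G (add_nonconst (pgcd (LC f) \<chi>) L) \<chi>)"
| final_done:
    "alg_step (Final {} G L \<chi>) (Returned \<chi> G L)"

text \<open>
  Termination for every resolution of the choices: no execution is infinite, and an execution
  that cannot be continued has arrived at an output (it never gets stuck, e.g. for
  want of a proper reduction).
\<close>

definition algorithm_terminates :: "'a::field mpol set \<Rightarrow> bool" where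
  "algorithm_terminates F \<longleftrightarrow>
     \<not> (\<exists>run. run 0 = start F \<and> (\<forall>i::nat. alg_step (run i) (run (Suc i)))) \<and>
     (\<forall>s. alg_step\<^sup>*\<^sup>* (start F) s \<longrightarrow> \<not> (\<exists>t. alg_step s t) \<longrightarrow>
        (\<exists>\<chi> G L. s = Returned \<chi> G L) \<or> (\<exists>G. s = Halted G))"

end

theory Submission
  imports Defs
begin

text \<open>
  Termination has two parts: no execution is infinite, and none gets stuck before an output.

  While the prebasis stays the same, the pairs to be treated, then the S-polynomials to be reduced
  and finally the elements of the prebasis are worked off one at a time.  An infinite execution
  would therefore have to enlarge the prebasis infinitely often.  It is enlarged only by a nonzero remainder,
  whose leading monomial is divisible by no leading monomial of the prebasis.  The leading monomials
  of the successively added remainders would form an infinite sequence in finitely many variables in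
  which no member divides a later one, contradicting Dickson's lemma (\<open>dickson\<close>,
  \<open>wf_prebasis_ext\<close>).  The lexicographic combination of prebasis, phase and remaining work
  decreases with every step that does not halt (\<open>rank_decreases\<close>).

  An execution could only get stuck for want of a proper reduction, so one has to be exhibited for
  every S-polynomial (\<open>ex_proper_reduction\<close>).  It reduces the largest reducible term again
  and again; this ends because the lexicographic order is well-founded, which is a second
  consequence of Dickson's lemma (\<open>wfp_lex_less\<close>).  The accompanying representation
  \<open>\<lambda> f = \<Sum> q b + r\<close> is accumulated along the reduction, and its degree condition
  holds because no reduced term exceeds the leading monomial of \<open>f\<close>
  (\<open>reduction_seq_cofactors\<close>).
\<close>

section \<open>Dickson's lemma\<close>

lemma mono_dvd_iff_lookup_le:
  "mono_dvd \<alpha> \<beta> \<longleftrightarrow> (\<forall>i. Poly_Mapping.lookup \<alpha> i \<le> Poly_Mapping.lookup \<beta> i)"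
proof
  assume "mono_dvd \<alpha> \<beta>"
  then show "\<forall>i. Poly_Mapping.lookup \<alpha> i \<le> Poly_Mapping.lookup \<beta> i"
    unfolding mono_dvd_def by (auto simp: lookup_add)
next
  assume "\<forall>i. Poly_Mapping.lookup \<alpha> i \<le> Poly_Mapping.lookup \<beta> i"
  then have "\<beta> = \<alpha> + (\<beta> - \<alpha>)"
    by (intro poly_mapping_eqI) (simp add: lookup_add lookup_minus)
  then show "mono_dvd \<alpha> \<beta>" unfolding mono_dvd_def by blast
qed

lemma mono_dvd_diff_add: "mono_dvd \<alpha> \<beta> \<Longrightarrow> \<beta> - \<alpha> + \<alpha> = \<beta>"
  unfolding mono_dvd_def by (auto simp: add.commute)

lemma nat_seq_has_mono_subseq:
  fixes s :: "nat \<Rightarrow> nat"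
  obtains \<phi> :: "nat \<Rightarrow> nat" where "strict_mono \<phi>" "mono (\<lambda>k. s (\<phi> k))"
proof -
  obtain f where f: "strict_mono f" "monoseq (\<lambda>k. s (f k))"
    using seq_monosub by blast
  show thesis
  proof (cases "mono (\<lambda>k. s (f k))")
    case True
    then show ?thesis using that f(1) by blast
  next
    case False
    then have dec: "s (f k) \<le> s (f j)" if "j \<le> k" for j k
      using f(2) that unfolding monoseq_def mono_def by blast
    obtain p where p: "\<And>k. s (f p) \<le> s (f k)"
      using ex_has_least_nat[of "\<lambda>_. True" _ "\<lambda>k. s (f k)"] by auto
    \<comment> \<open>A decreasing sequence of naturals is constant from its minimum on.\<close>
    have "s (f (p + k)) = s (f p)" for k
      using p[of "p + k"] dec[of p "p + k"] by simp
    moreover have "strict_mono (\<lambda>k. f (p + k))"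
      using f(1) by (simp add: strict_mono_def)
    ultimately show ?thesis
      using that[of "\<lambda>k. f (p + k)"] by (simp add: mono_def)
  qed
qed

text \<open>
  Passing to a monotone subsequence for one variable after the other makes the exponents of
  finitely many variables weakly increase simultaneously.
\<close>

lemma monomial_seq_has_mono_subseq:
  fixes m :: "nat \<Rightarrow> monomial"
  assumes "finite A"
  shows "\<exists>\<phi> :: nat \<Rightarrow> nat. strict_mono \<phi> \<and> (\<forall>i\<in>A. mono (\<lambda>k. Poly_Mapping.lookup (m (\<phi> k)) i))"
  using assms
proof (induction A)
  case empty
  show ?case by (intro exI[of _ id]) (simp add: strict_mono_def)
next
  case (insert a A)
  then obtain \<phi> :: "nat \<Rightarrow> nat" where \<phi>: "strict_mono \<phi>"
    "\<forall>i\<in>A. mono (\<lambda>k. Poly_Mapping.lookup (m (\<phi> k)) i)" by blast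
  obtain \<psi> :: "nat \<Rightarrow> nat" where \<psi>: "strict_mono \<psi>" "mono (\<lambda>k. Poly_Mapping.lookup (m (\<phi> (\<psi> k))) a)"
    using nat_seq_has_mono_subseq[of "\<lambda>k. Poly_Mapping.lookup (m (\<phi> k)) a"] by blast
  have "strict_mono (\<lambda>k. \<phi> (\<psi> k))"
    using \<phi>(1) \<psi>(1) by (simp add: strict_mono_def)
  moreover have "mono (\<lambda>k. Poly_Mapping.lookup (m (\<phi> (\<psi> k))) i)" if "i \<in> A" for i
    using \<phi>(2) that monoD[OF strict_mono_mono[OF \<psi>(1)]] by (simp add: mono_def)
  ultimately show ?case using \<psi>(2) by blast
qed

lemma dickson:
  fixes m :: "nat \<Rightarrow> monomial"
  assumes "finite A" and keys: "\<And>k. Poly_Mapping.keys (m k) \<subseteq> A"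
  obtains i j where "i < j" "mono_dvd (m i) (m j)"
proof -
  obtain \<phi> :: "nat \<Rightarrow> nat" where \<phi>: "strict_mono \<phi>"
    "\<forall>i\<in>A. mono (\<lambda>k. Poly_Mapping.lookup (m (\<phi> k)) i)"
    using monomial_seq_has_mono_subseq[OF assms(1), of m] by blast
  have "Poly_Mapping.lookup (m (\<phi> 0)) i \<le> Poly_Mapping.lookup (m (\<phi> 1)) i" for i
  proof (cases "i \<in> A")
    case True
    then show ?thesis using \<phi>(2) by (simp add: mono_def)
  next
    case False
    then have "i \<notin> Poly_Mapping.keys (m (\<phi> 0))" using keys by blast
    then show ?thesis by (simp add: in_keys_iff)
  qed
  then have "mono_dvd (m (\<phi> 0)) (m (\<phi> 1))" by (simp add: mono_dvd_iff_lookup_le)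
  moreover have "\<phi> 0 < \<phi> 1" using \<phi>(1) by (simp add: strict_mono_def)
  ultimately show thesis using that by blast
qed

section \<open>The lexicographic order\<close>

lemma lex_less_irrefl: "\<not> lex_less \<alpha> \<alpha>"
  by (simp add: lex_less_def)

lemma lex_less_trans: "lex_less \<alpha> \<beta> \<Longrightarrow> lex_less \<beta> \<gamma> \<Longrightarrow> lex_less \<alpha> \<gamma>"
proof -
  assume "lex_less \<alpha> \<beta>" "lex_less \<beta> \<gamma>"
  then obtain i j where
    i: "Poly_Mapping.lookup \<alpha> i < Poly_Mapping.lookup \<beta> i"
       "\<forall>k>i. Poly_Mapping.lookup \<alpha> k = Poly_Mapping.lookup \<beta> k" and
    j: "Poly_Mapping.lookup \<beta> j < Poly_Mapping.lookup \<gamma> j"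
       "\<forall>k>j. Poly_Mapping.lookup \<beta> k = Poly_Mapping.lookup \<gamma> k"
    unfolding lex_less_def by blast
  have "Poly_Mapping.lookup \<alpha> (max i j) < Poly_Mapping.lookup \<gamma> (max i j)"
    using i j by (cases i j rule: linorder_cases) (auto simp: max_def)
  moreover have "\<forall>k>max i j. Poly_Mapping.lookup \<alpha> k = Poly_Mapping.lookup \<gamma> k"
    using i j by simp
  ultimately show ?thesis unfolding lex_less_def by blast
qed

abbreviation lex_le :: "monomial \<Rightarrow> monomial \<Rightarrow> bool" where
  "lex_le \<alpha> \<beta> \<equiv> \<alpha> = \<beta> \<or> lex_less \<alpha> \<beta>"

lemma lex_le_trans: "lex_le \<alpha> \<beta> \<Longrightarrow> lex_le \<beta> \<gamma> \<Longrightarrow> lex_le \<alpha> \<gamma>"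
  using lex_less_trans by blast

lemma lex_le_antisym: "lex_le \<alpha> \<beta> \<Longrightarrow> lex_le \<beta> \<alpha> \<Longrightarrow> \<alpha> = \<beta>"
  using lex_less_trans lex_less_irrefl by metis

lemma lex_less_linear: "\<alpha> = \<beta> \<or> lex_less \<alpha> \<beta> \<or> lex_less \<beta> \<alpha>"
proof (rule ccontr)
  assume neg: "\<not> ?thesis"
  let ?D = "{i. Poly_Mapping.lookup \<alpha> i \<noteq> Poly_Mapping.lookup \<beta> i}"
  have "?D \<subseteq> Poly_Mapping.keys \<alpha> \<union> Poly_Mapping.keys \<beta>" by (auto simp: in_keys_iff)
  then have fin: "finite ?D" by (rule finite_subset) simp
  have "?D \<noteq> {}" using neg by (auto intro: poly_mapping_eqI)
  then have Max: "Max ?D \<in> ?D" using fin by (rule Max_in[rotated])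
  have "\<forall>j>Max ?D. Poly_Mapping.lookup \<alpha> j = Poly_Mapping.lookup \<beta> j"
    using Max_ge[OF fin] by (metis (mono_tags, lifting) leD mem_Collect_eq)
  then show False using neg Max unfolding lex_less_def
    by (metis (mono_tags, lifting) linorder_neqE_nat mem_Collect_eq)
qed

lemma lex_less_add_left: "lex_less \<alpha> \<beta> \<Longrightarrow> lex_less (\<gamma> + \<alpha>) (\<gamma> + \<beta>)"
  unfolding lex_less_def by (auto simp: lookup_add)

lemma mono_dvd_imp_not_lex_less: "mono_dvd \<alpha> \<beta> \<Longrightarrow> \<not> lex_less \<beta> \<alpha>"
  unfolding lex_less_def mono_dvd_iff_lookup_le by (meson not_le)

text \<open>
  There are infinitely many variables, but no monomial of a descending chain involves a variable
  beyond the largest one of its first member.  Dickson's lemma therefore applies to the chain, and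
  the order extends divisibility.
\<close>

lemma wfp_lex_less: "wfp lex_less"
  unfolding wfp_def wf_iff_no_infinite_down_chain
proof
  assume "\<exists>m. \<forall>i. (m (Suc i), m i) \<in> {(\<alpha>, \<beta>). lex_less \<alpha> \<beta>}"
  then obtain m where step: "\<And>i. lex_less (m (Suc i)) (m i)" by auto
  have desc: "lex_less (m j) (m i)" if "i < j" for i j
    using that by (induction rule: less_Suc_induct) (auto intro: step lex_less_trans)
  obtain N where N: "\<forall>k\<in>Poly_Mapping.keys (m 0). k \<le> N"
    using finite_nat_set_iff_bounded_le finite_keys by blast
  have "Poly_Mapping.keys (m i) \<subseteq> {..N}" for i
  proof (cases "i = 0")
    case False
    then obtain k where k: "Poly_Mapping.lookup (m i) k < Poly_Mapping.lookup (m 0) k"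
      "\<forall>j>k. Poly_Mapping.lookup (m i) j = Poly_Mapping.lookup (m 0) j"
      using desc[of 0 i] unfolding lex_less_def by auto
    have "k \<le> N" using k(1) N by (auto simp: in_keys_iff)
    show ?thesis
    proof
      fix j assume j: "j \<in> Poly_Mapping.keys (m i)"
      show "j \<in> {..N}"
      proof (cases "k < j")
        case True
        then have "j \<in> Poly_Mapping.keys (m 0)" using j k(2) by (simp add: in_keys_iff)
        then show ?thesis using N by simp
      qed (use \<open>k \<le> N\<close> in simp)
    qed
  qed (use N in auto)
  then obtain i j where "i < j" "mono_dvd (m i) (m j)"
    using dickson[of "{..N}" m] by blast
  then show False using desc mono_dvd_imp_not_lex_less by blast
qed

lemma ex_is_lex_max:
  assumes "finite M" "M \<noteq> {}"
  shows "\<exists>\<alpha>. is_lex_max M \<alpha>"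
  using assms
proof (induction M rule: finite_ne_induct)
  case (singleton x)
  then show ?case by (auto simp: is_lex_max_def)
next
  case (insert x M)
  then obtain \<alpha> where \<alpha>: "is_lex_max M \<alpha>" by blast
  show ?case
  proof (cases "lex_less \<alpha> x")
    case True
    then have "is_lex_max (insert x M) x"
      using \<alpha> by (auto simp: is_lex_max_def intro: lex_less_trans)
    then show ?thesis by blast
  next
    case False
    then have "is_lex_max (insert x M) \<alpha>"
      using \<alpha> lex_less_linear[of x \<alpha>] by (auto simp: is_lex_max_def)
    then show ?thesis by blast
  qed
qed

lemma is_lex_max_unique: "is_lex_max M \<alpha> \<Longrightarrow> is_lex_max M \<beta> \<Longrightarrow> \<alpha> = \<beta>"
  unfolding is_lex_max_def by (metis lex_less_trans lex_less_irrefl)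

lemma is_lex_max_LM:
  assumes "f \<noteq> 0"
  shows "is_lex_max (Poly_Mapping.keys f) (LM f)"
proof -
  have "Poly_Mapping.keys f \<noteq> {}" using assms by simp
  then obtain \<alpha> where \<alpha>: "is_lex_max (Poly_Mapping.keys f) \<alpha>"
    using ex_is_lex_max finite_keys by blast
  then have "LM f = \<alpha>"
    unfolding LM_def by (rule the_equality) (use \<alpha> in \<open>blast intro: is_lex_max_unique\<close>)
  then show ?thesis using \<alpha> by simp
qed

lemma LM_in_keys: "f \<noteq> 0 \<Longrightarrow> LM f \<in> Poly_Mapping.keys f"
  using is_lex_max_LM unfolding is_lex_max_def by blast

lemma keys_le_LM: "\<beta> \<in> Poly_Mapping.keys f \<Longrightarrow> lex_le \<beta> (LM f)"
  using is_lex_max_LM[of f] unfolding is_lex_max_def by fastforce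

lemma LC_nonzero: "f \<noteq> 0 \<Longrightarrow> LC f \<noteq> 0"
  using LM_in_keys[of f] by (simp add: LC_def in_keys_iff)

section \<open>Monic gcd and lcm of univariate polynomials\<close>

text \<open>
  Euclid's algorithm.  The induction measure puts \<open>0\<close> strictly below the nonzero constants,
  which \<open>degree\<close> alone does not separate.
\<close>

lemma ex_monic_gcd:
  fixes a b :: "'a::field poly"
  shows "\<exists>d. (d = 0 \<or> lead_coeff d = 1) \<and> d dvd a \<and> d dvd b \<and>
             (\<forall>e. e dvd a \<longrightarrow> e dvd b \<longrightarrow> e dvd d)"
proof (induction "if b = 0 then 0 else Suc (degree b)" arbitrary: a b rule: less_induct)
  case less
  show ?case
  proof (cases "b = 0")
    case True
    show ?thesis
    proof (cases "a = 0")
      case True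
      then show ?thesis using \<open>b = 0\<close> by (intro exI[of _ 0]) simp
    next
      case False
      let ?c = "inverse (lead_coeff a)"
      have "?c \<noteq> 0" using False by simp
      then have "smult ?c a dvd a" "\<forall>e. e dvd a \<longrightarrow> e dvd smult ?c a"
        by (auto simp: smult_dvd_iff dvd_smult)
      then show ?thesis using False \<open>b = 0\<close> by (intro exI[of _ "smult ?c a"]) simp
    qed
  next
    case False
    then have "(if a mod b = 0 then 0 else Suc (degree (a mod b)))
               < (if b = 0 then 0 else Suc (degree b))"
      using degree_mod_less'[of b a] by auto
    from less[OF this] obtain d where
      "d = 0 \<or> lead_coeff d = 1" "d dvd b" "d dvd a mod b"
      "\<forall>e. e dvd b \<longrightarrow> e dvd a mod b \<longrightarrow> e dvd d" by blast
    then show ?thesis by (metis dvd_mod dvd_mod_imp_dvd)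
  qed
qed

lemma monic_dvd_antisym:
  fixes d e :: "'a::field poly"
  assumes "d = 0 \<or> lead_coeff d = 1" "e = 0 \<or> lead_coeff e = 1" "d dvd e" "e dvd d"
  shows "d = e"
proof (cases "d = 0 \<or> e = 0")
  case False
  obtain k where k: "e = d * k" using assms(3) by blast
  have "degree e \<le> degree d" using assms(4) False by (auto intro: dvd_imp_degree_le)
  then have "degree k = 0" using k False by (auto simp: degree_mult_eq)
  then obtain c where c: "k = [:c:]" by (rule degree_eq_zeroE)
  have "lead_coeff e = lead_coeff d * lead_coeff k" using k by (simp add: lead_coeff_mult)
  then have "k = 1" using assms(1,2) False c by simp
  then show ?thesis using k by simp
qed (use assms in auto)

lemma pgcd_dvd:
  fixes a b :: "'a::field poly"
  shows "pgcd a b dvd a" and "pgcd a b dvd b"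
proof -
  have "\<exists>!d. (d = 0 \<or> lead_coeff d = 1) \<and> d dvd a \<and> d dvd b \<and>
             (\<forall>e. e dvd a \<longrightarrow> e dvd b \<longrightarrow> e dvd d)"
    using ex_monic_gcd[of a b] by (auto intro: monic_dvd_antisym)
  from theI'[OF this] show "pgcd a b dvd a" "pgcd a b dvd b"
    unfolding pgcd_def by blast+
qed

lemma plcm_nonzero_common_multiple:
  fixes a b :: "'a::field poly"
  assumes "a \<noteq> 0" "b \<noteq> 0"
  shows "plcm a b \<noteq> 0" "a dvd plcm a b" "b dvd plcm a b"
proof -
  define d where "d = pgcd a b"
  then obtain u v where u: "a = d * u" and v: "b = d * v"
    using pgcd_dvd[of a b] by (metis dvdE)
  have d: "d \<noteq> 0" using u assms(1) by auto
  have "plcm a b = (a * b) div d" by (simp add: plcm_def d_def)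
  then have lcm: "plcm a b = d * u * v" using d by (simp add: u v ac_simps)
  show "plcm a b \<noteq> 0" using assms unfolding lcm by (simp add: u v)
  show "a dvd plcm a b" "b dvd plcm a b" unfolding lcm by (simp_all add: u v)
qed

section \<open>Polynomials with coefficients in a polynomial ring\<close>

lemma lookup_scalar_mult:
  fixes p :: "'a::field mpol"
  shows "Poly_Mapping.lookup (scalar c * p) \<alpha> = c * Poly_Mapping.lookup p \<alpha>"
  by (simp add: mult_map_scale_conv_mult[symmetric] Poly_Mapping.map.rep_eq when_def)

lemma keys_scalar_mult:
  fixes p :: "'a::field mpol"
  shows "Poly_Mapping.keys (scalar c * p) \<subseteq> Poly_Mapping.keys p"
  by (auto simp: in_keys_iff lookup_scalar_mult)

lemma keys_single_mult:
  fixes g :: "'a::field mpol"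
  shows "Poly_Mapping.keys (Poly_Mapping.single \<gamma> c * g) \<subseteq> (+) \<gamma> ` Poly_Mapping.keys g"
  using keys_mult[of "Poly_Mapping.single \<gamma> c" g] by (auto split: if_splits)

lemma lookup_single_mult_add:
  fixes g :: "'a::field mpol"
  shows "Poly_Mapping.lookup (Poly_Mapping.single \<gamma> c * g) (\<gamma> + \<beta>) = c * Poly_Mapping.lookup g \<beta>"
  by (simp add: lookup_mult lookup_single when_mult)

lemma keys_diff_subset:
  fixes p q :: "'a::field mpol"
  shows "Poly_Mapping.keys (p - q) \<subseteq> Poly_Mapping.keys p \<union> Poly_Mapping.keys q"
  by (auto simp: in_keys_iff lookup_minus)

lemma mpols_mult: "p \<in> mpols n \<Longrightarrow> q \<in> mpols n \<Longrightarrow> p * (q :: 'a::field mpol) \<in> mpols n"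
  unfolding mpols_def
proof clarsimp
  fix \<alpha> i
  assume *: "\<forall>\<alpha>\<in>Poly_Mapping.keys p. Poly_Mapping.keys \<alpha> \<subseteq> {2..n}"
    "\<forall>\<alpha>\<in>Poly_Mapping.keys q. Poly_Mapping.keys \<alpha> \<subseteq> {2..n}"
    and "\<alpha> \<in> Poly_Mapping.keys (p * q)" and i: "i \<in> Poly_Mapping.keys \<alpha>"
  then obtain \<beta> \<gamma> where "\<beta> \<in> Poly_Mapping.keys p" "\<gamma> \<in> Poly_Mapping.keys q" "\<alpha> = \<beta> + \<gamma>"
    using keys_mult[of p q] by blast
  then show "2 \<le> i \<and> i \<le> n" using * i Poly_Mapping.keys_add[of \<beta> \<gamma>] by fastforce
qed

lemma mpols_diff: "p \<in> mpols n \<Longrightarrow> q \<in> mpols n \<Longrightarrow> p - (q :: 'a::field mpol) \<in> mpols n"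
  unfolding mpols_def using keys_diff_subset[of p q] by blast

lemma mpols_single: "Poly_Mapping.keys \<alpha> \<subseteq> {2..n} \<Longrightarrow> Poly_Mapping.single \<alpha> c \<in> mpols n"
  unfolding mpols_def by (auto split: if_splits)

lemma mpols_term_quot:
  assumes "Poly_Mapping.keys \<alpha> \<subseteq> {2..n}"
  shows "term_quot m \<alpha> g \<in> mpols n"
  unfolding term_quot_def
  by (rule mpols_single) (use assms in \<open>auto simp: in_keys_iff lookup_minus subset_iff\<close>)

lemma keys_LM_mpols:
  assumes "f \<in> mpols n" "f \<noteq> 0"
  shows "Poly_Mapping.keys (LM f) \<subseteq> {2..n}"
  using LM_in_keys[OF assms(2)] assms(1) unfolding mpols_def by blast

lemma mpols_spoly:
  assumes "f \<in> mpols n" "g \<in> mpols n" "f \<noteq> 0" "g \<noteq> 0"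
  shows "spoly f g \<in> mpols n"
proof -
  have "Poly_Mapping.keys (mono_lcm (LM f) (LM g))
        \<subseteq> Poly_Mapping.keys (LM f) \<union> Poly_Mapping.keys (LM g)"
    by (auto simp: in_keys_iff mono_lcm.rep_eq max_def split: if_splits)
  then have "Poly_Mapping.keys (mono_lcm (LM f) (LM g)) \<subseteq> {2..n}"
    using keys_LM_mpols assms by blast
  then show ?thesis
    unfolding spoly_def Let_def using assms by (intro mpols_diff mpols_mult mpols_term_quot)
qed

section \<open>Proper reductions\<close>

lemma keys_term_quot_mult:
  fixes g :: "'a::field mpol"
  assumes "mono_dvd (LM g) \<alpha>" "\<beta> \<in> Poly_Mapping.keys (term_quot m \<alpha> g * g)"
  shows "lex_le \<beta> \<alpha>"
proof -
  obtain \<delta> where \<delta>: "\<delta> \<in> Poly_Mapping.keys g" "\<beta> = \<alpha> - LM g + \<delta>"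
    using assms(2) keys_single_mult unfolding term_quot_def by blast
  then show ?thesis
    using keys_le_LM[OF \<delta>(1)] lex_less_add_left[of \<delta> "LM g" "\<alpha> - LM g"]
      mono_dvd_diff_add[OF assms(1)] by auto
qed

lemma lookup_term_quot_mult:
  fixes g :: "'a::field mpol"
  assumes "mono_dvd (LM g) \<alpha>" "LC g dvd m"
  shows "Poly_Mapping.lookup (term_quot m \<alpha> g * g) \<alpha> = m"
  using lookup_single_mult_add[of "\<alpha> - LM g" "m div LC g" g "LM g"] assms
  by (simp add: term_quot_def mono_dvd_diff_add LC_def[symmetric])

lemma term_reduction_multiplier_nonzero:
  assumes "term_reduction p \<alpha> g \<mu> p'"
  shows "\<mu> \<noteq> 0"
proof -
  let ?c = "Poly_Mapping.lookup p \<alpha>"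
  have "?c \<noteq> 0" "LC g \<noteq> 0"
    using assms LC_nonzero by (auto simp: term_reduction_def in_keys_iff)
  from plcm_nonzero_common_multiple[OF this] assms show ?thesis
    by (auto simp: term_reduction_def Let_def dvd_div_eq_0_iff)
qed

text \<open>
  The multiple of \<open>g\<close> that is subtracted has leading term \<open>m x\<^sup>\<alpha>\<close>, which is the term of
  \<open>scalar \<mu> * p\<close> at \<open>\<alpha>\<close>.  Hence a term reduction cancels the term at \<open>\<alpha>\<close> and disturbs only
  smaller ones.
\<close>

lemma term_reduction_keys:
  fixes p :: "'a::field mpol"
  assumes "term_reduction p \<alpha> g \<mu> p'" "\<beta> \<in> Poly_Mapping.keys p'"
  shows "lex_less \<beta> \<alpha> \<or> (\<beta> \<in> Poly_Mapping.keys p \<and> \<beta> \<noteq> \<alpha>)"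
proof -
  let ?c = "Poly_Mapping.lookup p \<alpha>"
  let ?m = "plcm ?c (LC g)"
  have dvd: "mono_dvd (LM g) \<alpha>" and \<mu>: "\<mu> = ?m div ?c"
    and p': "p' = scalar \<mu> * p - term_quot ?m \<alpha> g * g" and nz: "?c \<noteq> 0" "LC g \<noteq> 0"
    using assms(1) LC_nonzero by (auto simp: term_reduction_def Let_def in_keys_iff)
  note m = plcm_nonzero_common_multiple[OF nz]
  have "Poly_Mapping.lookup p' \<alpha> = \<mu> * ?c - ?m"
    using m dvd by (simp add: p' lookup_minus lookup_scalar_mult lookup_term_quot_mult)
  then have "\<beta> \<noteq> \<alpha>" using assms(2) m \<mu> by (auto simp: in_keys_iff)
  moreover have "\<beta> \<in> Poly_Mapping.keys p \<or> \<beta> \<in> Poly_Mapping.keys (term_quot ?m \<alpha> g * g)"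
    using assms(2) keys_diff_subset keys_scalar_mult unfolding p' by blast
  ultimately show ?thesis using keys_term_quot_mult[OF dvd] by blast
qed

lemma reduction_seq_mpols:
  assumes "reduction_seq B f l r" "B \<subseteq> mpols n" "f \<in> mpols n"
  shows "r \<in> mpols n"
  using assms
proof (induction rule: reduction_seq.induct)
  case (step l p g \<alpha> \<mu> p')
  then have p: "p \<in> mpols n" and g: "g \<in> mpols n" by auto
  have "\<alpha> \<in> Poly_Mapping.keys p" using step.hyps by (simp add: term_reduction_def)
  then have "Poly_Mapping.keys \<alpha> \<subseteq> {2..n}" using p by (auto simp: mpols_def)
  then show ?case
    using step.hyps p g unfolding term_reduction_def Let_def
    by (auto intro!: mpols_diff mpols_mult mpols_term_quot mpols_single)
qed

lemma reduction_seq_multiplier_nonzero: "reduction_seq B f l r \<Longrightarrow> l \<noteq> 0"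
  by (induction rule: reduction_seq.induct) (auto dest: term_reduction_multiplier_nonzero)

text \<open>
  Each step multiplies the representation of \<open>scalar l * f\<close> by the least multiplier and adds the
  subtracted multiple of \<open>g\<close> to the summand of \<open>g\<close>.  The monomial \<open>\<alpha>\<close> of the reduced term never
  exceeds \<open>LM f\<close>, so neither do the monomials of the summands.
\<close>

lemma reduction_seq_cofactors:
  fixes f :: "'a::field mpol"
  assumes "reduction_seq B f l r" "finite B"
  shows "\<exists>q. scalar l * f = (\<Sum>b\<in>B. q b * b) + r \<and>
             (\<forall>b\<in>B. \<forall>\<beta>\<in>Poly_Mapping.keys (q b * b). lex_le \<beta> (LM f)) \<and>
             (\<forall>\<beta>\<in>Poly_Mapping.keys r. lex_le \<beta> (LM f))"
  using assms(1)
proof (induction rule: reduction_seq.induct)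
  case refl
  show ?case by (rule exI[of _ "\<lambda>_. 0"]) (auto dest: keys_le_LM)
next
  case (step l p g \<alpha> \<mu> p')
  then obtain q where
    q: "scalar l * f = (\<Sum>b\<in>B. q b * b) + p"
       "\<forall>b\<in>B. \<forall>\<beta>\<in>Poly_Mapping.keys (q b * b). lex_le \<beta> (LM f)" and
    p: "\<forall>\<beta>\<in>Poly_Mapping.keys p. lex_le \<beta> (LM f)" by blast
  obtain t where \<alpha>: "\<alpha> \<in> Poly_Mapping.keys p" and p': "p' = scalar \<mu> * p - t * g"
    and t: "\<And>\<beta>. \<beta> \<in> Poly_Mapping.keys (t * g) \<Longrightarrow> lex_le \<beta> \<alpha>"
    using step.hyps(3) keys_term_quot_mult unfolding term_reduction_def Let_def by blast
  have t': "lex_le \<beta> (LM f)" if "\<beta> \<in> Poly_Mapping.keys (t * g)" for \<beta>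
    using lex_le_trans[OF t[OF that]] p \<alpha> by blast
  define q' where "q' b = scalar \<mu> * q b + (if b = g then t else 0)" for b
  have "scalar (\<mu> * l) * f = scalar \<mu> * (scalar l * f)"
    by (simp add: mult.assoc[symmetric] mult_single)
  also have "\<dots> = (\<Sum>b\<in>B. scalar \<mu> * (q b * b)) + t * g + p'"
    by (simp add: q(1) p' distrib_left sum_distrib_left)
  also have "(\<Sum>b\<in>B. scalar \<mu> * (q b * b)) + t * g = (\<Sum>b\<in>B. q' b * b)"
    using assms(2) step.hyps(2)
    by (simp add: q'_def distrib_right sum.distrib mult.assoc if_distrib[of "\<lambda>x. x * _"]
        sum.delta cong: if_cong)
  finally have "scalar (\<mu> * l) * f = (\<Sum>b\<in>B. q' b * b) + p'" .
  moreover have "lex_le \<beta> (LM f)"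
    if "b \<in> B" "\<beta> \<in> Poly_Mapping.keys (q' b * b)" for b \<beta>
  proof -
    have "q' b * b = scalar \<mu> * (q b * b) + (if b = g then t * g else 0)"
      by (simp add: q'_def distrib_right mult.assoc)
    then have "\<beta> \<in> Poly_Mapping.keys (q b * b) \<or> \<beta> \<in> Poly_Mapping.keys (t * g)"
      using that(2) Poly_Mapping.keys_add[of "scalar \<mu> * (q b * b)"
          "if b = g then t * g else 0"] keys_scalar_mult[of \<mu> "q b * b"]
      by (auto split: if_splits)
    then show ?thesis using q(2) t' that(1) by blast
  qed
  moreover have "lex_le \<beta> (LM f)" if "\<beta> \<in> Poly_Mapping.keys p'" for \<beta>
    using term_reduction_keys[OF step.hyps(3) that] p \<alpha> lex_le_trans[of \<beta> \<alpha> "LM f"] by blast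
  ultimately show ?case by blast
qed

text \<open>
  The maximum in a proper reduction is attained because \<open>LM f\<close> is a monomial of \<open>scalar l * f\<close>
  and hence of some summand, where nothing larger occurs.
\<close>

lemma reduction_seq_imp_proper_reduction:
  fixes f :: "'a::field mpol"
  assumes red: "reduction_seq B f l r" and "finite B"
    and irred: "\<forall>\<alpha>\<in>Poly_Mapping.keys r. \<forall>b\<in>B. \<not> mono_dvd (LM b) \<alpha>"
  shows "proper_reduction B f l r"
proof -
  obtain q where
    q: "scalar l * f = (\<Sum>b\<in>B. q b * b) + r"
       "\<forall>b\<in>B. \<forall>\<beta>\<in>Poly_Mapping.keys (q b * b). lex_le \<beta> (LM f)"
       "\<forall>\<beta>\<in>Poly_Mapping.keys r. lex_le \<beta> (LM f)"
    using reduction_seq_cofactors[OF red assms(2)] by blast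
  have l: "l \<noteq> 0" using red by (rule reduction_seq_multiplier_nonzero)
  define H where "H = ((\<lambda>b. q b * b) ` B \<union> {r}) - {0}"
  have H: "lex_le \<beta> (LM f)" if "h \<in> H" "\<beta> \<in> Poly_Mapping.keys h" for h \<beta>
    using that q(2,3) unfolding H_def by blast
  have "is_lex_max (LM ` H) (LM f)" if "f \<noteq> 0"
  proof -
    have "Poly_Mapping.lookup (scalar l * f) (LM f) \<noteq> 0"
      using l LC_nonzero[OF that] by (simp add: lookup_scalar_mult LC_def)
    then have "LM f \<in> Poly_Mapping.keys ((\<Sum>b\<in>B. q b * b) + r)"
      by (simp add: q(1) in_keys_iff)
    then have "LM f \<in> Poly_Mapping.keys (\<Sum>b\<in>B. q b * b) \<or> LM f \<in> Poly_Mapping.keys r"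
      using Poly_Mapping.keys_add[of "\<Sum>b\<in>B. q b * b" r] by blast
    then have "(\<exists>b\<in>B. LM f \<in> Poly_Mapping.keys (q b * b)) \<or> LM f \<in> Poly_Mapping.keys r"
      using keys_sum[of "\<lambda>b. q b * b" B] by blast
    then obtain h where "h \<in> (\<lambda>b. q b * b) ` B \<union> {r}" "LM f \<in> Poly_Mapping.keys h"
      by blast
    then have h: "h \<in> H" "LM f \<in> Poly_Mapping.keys h" by (auto simp: H_def)
    have "LM h = LM f"
      using h H[OF h(1) LM_in_keys] keys_le_LM[OF h(2)] by (intro lex_le_antisym) (auto simp: H_def)
    then have "LM f \<in> LM ` H" using h(1) by (metis imageI)
    moreover have "lex_le (LM h) (LM f)" if "h \<in> H" for h
      using H[OF that LM_in_keys] that by (auto simp: H_def)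
    ultimately show ?thesis unfolding is_lex_max_def by blast
  qed
  then show ?thesis unfolding proper_reduction_def H_def using red l irred q(1) by blast
qed

text \<open>
  Reducing the largest reducible term first works: the largest reducible monomial strictly
  decreases, as a term reduction leaves the larger terms irreducible, and the lexicographic order
  is well-founded.
\<close>

lemma ex_proper_reduction:
  fixes f :: "'a::field mpol"
  assumes "finite B" "0 \<notin> B"
  shows "\<exists>l r. proper_reduction B f l r"
proof -
  define R where "R p = {\<alpha> \<in> Poly_Mapping.keys p. \<exists>b\<in>B. mono_dvd (LM b) \<alpha>}" for p :: "'a mpol"
  have reach: "\<exists>l r. reduction_seq B f l r \<and> R r = {}"
    if "reduction_seq B f l p" "\<forall>\<beta>\<in>R p. lex_less \<beta> \<alpha>" for l p \<alpha>
    using that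
  proof (induction \<alpha> arbitrary: l p rule: wfp_induct_rule[OF wfp_lex_less])
    case (1 \<alpha>)
    show ?case
    proof (cases "R p = {}")
      case True
      then show ?thesis using 1(2) by blast
    next
      case False
      have "finite (R p)" by (simp add: R_def)
      then obtain \<gamma> where \<gamma>: "is_lex_max (R p) \<gamma>" using False ex_is_lex_max by blast
      then have "\<gamma> \<in> R p" by (simp add: is_lex_max_def)
      then obtain g where g: "g \<in> B" "mono_dvd (LM g) \<gamma>" "\<gamma> \<in> Poly_Mapping.keys p"
        by (auto simp: R_def)
      then have "g \<noteq> 0" using assms(2) by blast
      then obtain \<mu> p' where red: "term_reduction p \<gamma> g \<mu> p'"
        using g by (auto simp: term_reduction_def Let_def)
      have "lex_less \<beta> \<gamma>" if "\<beta> \<in> R p'" for \<beta>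
        using that term_reduction_keys[OF red, of \<beta>] \<gamma> by (auto simp: R_def is_lex_max_def)
      moreover have "lex_less \<gamma> \<alpha>" using 1(3) \<open>\<gamma> \<in> R p\<close> by blast
      moreover have "reduction_seq B f (\<mu> * l) p'"
        using 1(2) g(1) red by (rule reduction_seq.step)
      ultimately show ?thesis using 1(1) by blast
    qed
  qed
  \<comment> \<open>A strict upper bound for the monomials of \<open>f\<close>, from which the descent starts.\<close>
  have "lex_less \<beta> (LM f + Poly_Mapping.single 0 1)" if "\<beta> \<in> R f" for \<beta>
  proof -
    have "lex_less (0 :: monomial) (Poly_Mapping.single 0 1)"
      unfolding lex_less_def by (intro exI[of _ 0]) (simp add: lookup_single)
    from lex_less_add_left[OF this, of "LM f"]
    show ?thesis using that keys_le_LM[of \<beta> f] by (auto simp: R_def intro: lex_less_trans)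
  qed
  then obtain l r where "reduction_seq B f l r" "R r = {}"
    using reach reduction_seq.refl by blast
  then have "proper_reduction B f l r"
    using assms(1) by (intro reduction_seq_imp_proper_reduction) (auto simp: R_def)
  then show ?thesis by blast
qed

section \<open>Termination of the algorithm\<close>

definition is_prebasis :: "nat \<Rightarrow> 'a::field mpol set \<Rightarrow> bool" where
  "is_prebasis n G \<longleftrightarrow> finite G \<and> G \<subseteq> mpols n - range scalar"

fun state_inv :: "nat \<Rightarrow> 'a::field state \<Rightarrow> bool" where
  "state_inv n (Pairs Q G L SS \<chi>) \<longleftrightarrow>
     is_prebasis n G \<and> finite Q \<and> Q \<subseteq> {{f, g} | f g. f \<in> G \<and> g \<in> G \<and> f \<noteq> g} \<and>
     finite SS \<and> SS \<subseteq> mpols n"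
| "state_inv n (Reduce G L SS \<chi>) \<longleftrightarrow> is_prebasis n G \<and> finite SS \<and> SS \<subseteq> mpols n"
| "state_inv n (Final T G L \<chi>) \<longleftrightarrow> finite T"
| "state_inv n (Returned \<chi> G L) \<longleftrightarrow> True"
| "state_inv n (Halted G) \<longleftrightarrow> True"

lemma zero_notin_prebasis: "is_prebasis n G \<Longrightarrow> 0 \<notin> G"
  unfolding is_prebasis_def by (metis DiffD2 rangeI single_zero subsetD)

text \<open>
  The larger prebasis is the first component, so that well-foundedness excludes infinite ascending
  chains.
\<close>

definition prebasis_ext :: "nat \<Rightarrow> ('a::field mpol set \<times> 'a mpol set) set" where
  "prebasis_ext n =
     {(insert r G, G) | r G. r \<in> mpols n \<and> r \<noteq> 0 \<and> (\<forall>b\<in>G. \<not> mono_dvd (LM b) (LM r))}"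

text \<open>
  The polynomial \<open>r i\<close> added at stage \<open>i\<close> still belongs to all later prebases.  Hence
  its leading monomial divides that of no later \<open>r j\<close>, which Dickson's lemma forbids.
\<close>

lemma wf_prebasis_ext: "wf (prebasis_ext n :: ('a::field mpol set \<times> 'a mpol set) set)"
  unfolding wf_iff_no_infinite_down_chain
proof
  assume "\<exists>G. \<forall>i. (G (Suc i), G i) \<in> (prebasis_ext n :: ('a mpol set \<times> 'a mpol set) set)"
  then obtain G :: "nat \<Rightarrow> 'a mpol set" where "\<forall>i. (G (Suc i), G i) \<in> prebasis_ext n" by blast
  then have "\<forall>i. \<exists>r. G (Suc i) = insert r (G i) \<and> r \<in> mpols n \<and> r \<noteq> 0 \<and>
                     (\<forall>b\<in>G i. \<not> mono_dvd (LM b) (LM r))"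
    unfolding prebasis_ext_def by blast
  then obtain r where
    r: "\<And>i. G (Suc i) = insert (r i) (G i)" "\<And>i. r i \<in> mpols n" "\<And>i. r i \<noteq> 0"
       "\<And>i b. b \<in> G i \<Longrightarrow> \<not> mono_dvd (LM b) (LM (r i))" by metis
  obtain i j where "i < j" "mono_dvd (LM (r i)) (LM (r j))"
    using dickson[of "{2..n}" "\<lambda>i. LM (r i)"] keys_LM_mpols r(2,3) by blast
  moreover have "r i \<in> G j"
  proof -
    have "G (Suc i) \<subseteq> G j" using \<open>i < j\<close> r(1) lift_Suc_mono_le[of G "Suc i" j] by auto
    then show ?thesis using r(1) by blast
  qed
  ultimately show False using r(4) by blast
qed

text \<open>
  Between two extensions of the prebasis the phases follow each other in a fixed order, and each
  of them works off a finite set.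
\<close>

fun rank :: "'a::field state \<Rightarrow> 'a mpol set \<times> nat \<times> nat" where
  "rank (Pairs Q G L SS \<chi>) = (G, 3, card Q)"
| "rank (Reduce G L SS \<chi>) = (G, 2, card SS)"
| "rank (Final T G L \<chi>) = (G, 1, card T)"
| "rank (Returned \<chi> G L) = (G, 0, 0)"
| "rank (Halted G) = (G, 0, 0)"

definition rank_less :: "nat \<Rightarrow> (('a::field mpol set \<times> nat \<times> nat) \<times> _) set" where
  "rank_less n = prebasis_ext n <*lex*> less_than <*lex*> less_than"

lemma wf_rank_less: "wf (rank_less n)"
  unfolding rank_less_def by (intro wf_lex_prod wf_prebasis_ext wf_less_than)

lemma proper_reduction_extends_prebasis:
  assumes "is_prebasis n G" "S \<in> mpols n" "proper_reduction G S l r" "r \<notin> range scalar"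
  shows "is_prebasis n (insert r G)" "(insert r G, G) \<in> prebasis_ext n"
proof -
  have "r \<noteq> 0" using assms(4) by (metis rangeI single_zero)
  moreover have r: "r \<in> mpols n"
    using assms(1-3) reduction_seq_mpols[of G S l r n]
    unfolding proper_reduction_def is_prebasis_def by blast
  ultimately show "(insert r G, G) \<in> prebasis_ext n"
    using assms(3) LM_in_keys unfolding prebasis_ext_def proper_reduction_def by blast
  show "is_prebasis n (insert r G)" using assms(1,4) r by (simp add: is_prebasis_def)
qed

lemma exec_pair_spolys:
  assumes "exec_pair G f g (L, SS) (L', SS')"
  shows "SS' \<subseteq> insert (spoly f g) SS"
  using assms by cases auto

lemma state_inv_step:
  assumes "alg_step s t" "state_inv n s"
  shows "state_inv n t"
  using assms
proof cases
  case (pair f g Q G L SS L' SS' \<chi>)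
  then have fg: "f \<in> G" "g \<in> G" and G: "is_prebasis n G"
    using assms(2) by (auto simp: doubleton_eq_iff)
  then have "spoly f g \<in> mpols n"
    using zero_notin_prebasis[OF G] by (intro mpols_spoly) (auto simp: is_prebasis_def)
  then show ?thesis
    using assms(2) pair exec_pair_spolys[OF pair(5)]
    by (auto intro: finite_subset)
next
  case (reduce_new S SS G l r L \<chi>)
  have "is_prebasis n (insert r G)"
    using reduce_new assms(2) proper_reduction_extends_prebasis by fastforce
  moreover have "finite {{f, r} | f. f \<in> insert r G - {r}}"
    using reduce_new assms(2) by (simp add: is_prebasis_def)
  ultimately show ?thesis using reduce_new assms(2) by auto
qed (auto simp: is_prebasis_def)

text \<open>
  Halting replaces the prebasis by \<open>{1}\<close>, which does not extend the old one.  As it happens at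
  most once, at the end of an execution, it is harmless to leave it out.
\<close>

lemma rank_decreases:
  assumes "alg_step s t" "state_inv n s" "\<nexists>G. t = Halted G"
  shows "(rank t, rank s) \<in> rank_less n"
  using assms
proof cases
  case (reduce_new S SS G l r L \<chi>)
  then show ?thesis
    using assms(2) proper_reduction_extends_prebasis[of n G S l r]
    by (auto simp: rank_less_def)
qed (auto simp: rank_less_def card_Diff1_less simp del: card_Diff_singleton card_Diff_insert)

lemma no_infinite_run:
  assumes "state_inv n (run 0)" "\<And>i. alg_step (run i) (run (Suc i))"
  shows False
proof -
  have inv: "state_inv n (run i)" for i
    by (induction i) (auto intro: assms state_inv_step)
  have "\<nexists>G. run (Suc i) = Halted G" for i
    using assms(2)[of "Suc i"] by (auto elim: alg_step.cases)
  then have "(rank (run (Suc i)), rank (run i)) \<in> rank_less n" for i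
    using rank_decreases assms(2) inv by blast
  then show False
    using wf_no_infinite_down_chainE[OF wf_rank_less, of "\<lambda>i. rank (run i)" n] by blast
qed

lemma ex_exec_pair: "\<exists>L' SS'. exec_pair G f g (L, SS) (L', SS')"
  by (meson exec_pair.intros)

lemma progress:
  assumes "state_inv n s" "\<nexists>\<chi> G L. s = Returned \<chi> G L" "\<nexists>G. s = Halted G"
  shows "\<exists>t. alg_step s t"
proof (cases s)
  case (Pairs Q G L SS \<chi>)
  show ?thesis
  proof (cases "Q = {}")
    case True
    then show ?thesis using Pairs alg_step.pairs_done by blast
  next
    case False
    then obtain f g where "{f, g} \<in> Q" "f \<noteq> g" using assms(1) Pairs by fastforce
    then show ?thesis using Pairs alg_step.pair ex_exec_pair by metis
  qed
next
  case (Reduce G L SS \<chi>)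
  show ?thesis
  proof (cases "SS = {}")
    case True
    then show ?thesis using Reduce alg_step.reduce_done by blast
  next
    case False
    then obtain S where S: "S \<in> SS" by blast
    have G: "is_prebasis n G" using assms(1) Reduce by simp
    then obtain l r where red: "proper_reduction G S l r"
      using ex_proper_reduction[of G S] zero_notin_prebasis[OF G]
      by (auto simp: is_prebasis_def)
    show ?thesis
    proof (cases "r \<in> range scalar")
      case True
      then obtain c where c: "r = scalar c" by blast
      consider "0 < degree c" | "c = 0" | "c \<noteq> 0" "degree c = 0" by blast
      then show ?thesis
      proof cases
        case 2
        then have "r = 0" using c by simp
        then show ?thesis using Reduce alg_step.reduce_zero[OF S red] by blast
      qed (use Reduce alg_step.reduce_eliminant[OF S red c]
            alg_step.reduce_unit[OF S red c] in blast)+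
    next
      case False
      then show ?thesis using Reduce alg_step.reduce_new[OF S red] by blast
    qed
  qed
next
  case (Final T G L \<chi>)
  then show ?thesis using alg_step.final alg_step.final_done by (cases "T = {}") blast+
qed (use assms in auto)

theorem lemma3p9:
  fixes F :: "'a::field mpol set" and n :: nat
  assumes "1 \<le> n"
    and "finite F"
    and "F \<subseteq> mpols n - range scalar"
    and "zero_dimensional n (ideal_gen n F)"
  shows "algorithm_terminates F"
proof -
  have "finite {{f, g} | f g. f \<in> F \<and> g \<in> F \<and> f \<noteq> g}"
    by (rule finite_subset[of _ "Pow F"]) (use assms(2) in auto)
  then have init: "state_inv n (start F)"
    using assms(2,3) by (simp add: start_def is_prebasis_def)
  have "state_inv n s" if "alg_step\<^sup>*\<^sup>* (start F) s" for s
    using that by (induction rule: rtranclp_induct) (auto intro: init state_inv_step)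
  then show ?thesis
    unfolding algorithm_terminates_def using progress no_infinite_run init by metis
qed

end
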